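(* Suppose there are no missing or duplicate rankings. Let $v_r^{ROC}=\Big(\sum_{h=r}^K\frac1h\Big)\Big/K$ denote the rank order centroid weight of the alternative ranked $r$. Then the optimal weight $w^*_{ijr}$ of the alternative ranked $r$ under expert $i$ and attribute $j$ in the Ordinal Priority Approach (OPA) can be expressed as $$w^*_{ijr}=\frac{v_r^{ROC}}{t_is_{ij}\big(\sum_{p=1}^I\frac1p\big)\big(\sum_{q=1}^J\frac1q\big)},\qquad\forall i\in[I],\ j\in[J],\ r\in[K],$$ which implies that the rank order centroid weight is a special case of OPA for determining the weights of alternatives when the importance of experts and attributes is equal.
   Context: $[n]=\{1,\dots,n\}$. There are $I$ experts, $J$ attributes and $K$ alternatives. $t_i\in[I]$ is the rank of expert $i$, $s_{ij}\in[J]$ is the rank of attribute $j$ given by expert $i$, and each expert ranks the $K$ alternatives under each attribute (rank 1 is the most important). No missing or duplicate rankings means that $(t_i)_{i\in[I]}$ is a permutation of $[I]$, that for each $i$ $(s_{ij})_{j\in[J]}$ is a permutation of $[J]$, and that for each $(i,j)$ the alternatives receive each of the ranks $1,\dots,K$ exactly once. In this case the OPA model is the linear program in $z$ and $\mathbf w=(w_{ijr})$: $$\max z\ \text{ s.t. }\Big(\sum_{h=r}^{K}\tfrac1h\Big)z\le t_is_{ij}w_{ijr}\ \ \forall i,j,r,\quad\sum_{i=1}^I\sum_{j=1}^J\sum_{r=1}^Kw_{ijr}=1,\quad w_{ijr}\ge0\ \ \forall i,j,r,$$ where $w_{ijr}$ is the weight of the alternative ranked $r$ under expert $i$ and attribute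 $j$; $w^*_{ijr}$ denotes its optimal solution. *)

theory Defs
  imports Complex_Main
begin

text \<open>
  Experts, attributes and ranks are indexed by \<open>{1..I}\<close>, \<open>{1..J}\<close>, \<open>{1..K}\<close>; values of the data
  and of the variables outside these index sets are irrelevant. \<open>t i\<close> is the rank of expert \<open>i\<close>,
  \<open>s i j\<close> the rank expert \<open>i\<close> gives to attribute \<open>j\<close>, and \<open>rk i j k\<close> the rank expert \<open>i\<close> gives to
  alternative \<open>k\<close> under attribute \<open>j\<close>.
\<close>

definition no_missing_or_duplicate_rankings ::
  "nat \<Rightarrow> nat \<Rightarrow> nat \<Rightarrow> (nat \<Rightarrow> nat) \<Rightarrow> (nat \<Rightarrow> nat \<Rightarrow> nat) \<Rightarrow> (nat \<Rightarrow> nat \<Rightarrow> nat \<Rightarrow> nat) \<Rightarrow> bool"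
  where
  "no_missing_or_duplicate_rankings I J K t s rk \<longleftrightarrow>
     bij_betw t {1..I} {1..I} \<and>
     (\<forall>i\<in>{1..I}. bij_betw (s i) {1..J} {1..J}) \<and>
     (\<forall>i\<in>{1..I}. \<forall>j\<in>{1..J}. bij_betw (rk i j) {1..K} {1..K})"

text \<open>
  The third index of \<open>w\<close> is a rank, not the name of an alternative: \<open>w i j r\<close> is the weight of
  whichever alternative is ranked \<open>r\<close> by expert \<open>i\<close> under attribute \<open>j\<close>. The variable \<open>z\<close> is free
  in sign.
\<close>

definition opa_feasible ::
  "nat \<Rightarrow> nat \<Rightarrow> nat \<Rightarrow> (nat \<Rightarrow> nat) \<Rightarrow> (nat \<Rightarrow> nat \<Rightarrow> nat) \<Rightarrow> real \<Rightarrow> (nat \<Rightarrow> nat \<Rightarrow> nat \<Rightarrow> real) \<Rightarrow> bool"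
  where
  "opa_feasible I J K t s z w \<longleftrightarrow>
     (\<forall>i\<in>{1..I}. \<forall>j\<in>{1..J}. \<forall>r\<in>{1..K}.
        (\<Sum>h=r..K. 1 / real h) * z \<le> real (t i) * real (s i j) * w i j r) \<and>
     (\<Sum>i=1..I. \<Sum>j=1..J. \<Sum>r=1..K. w i j r) = 1 \<and>
     (\<forall>i\<in>{1..I}. \<forall>j\<in>{1..J}. \<forall>r\<in>{1..K}. 0 \<le> w i j r)"

definition opa_optimal ::
  "nat \<Rightarrow> nat \<Rightarrow> nat \<Rightarrow> (nat \<Rightarrow> nat) \<Rightarrow> (nat \<Rightarrow> nat \<Rightarrow> nat) \<Rightarrow> real \<Rightarrow> (nat \<Rightarrow> nat \<Rightarrow> nat \<Rightarrow> real) \<Rightarrow> bool"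
  where
  "opa_optimal I J K t s z w \<longleftrightarrow>
     opa_feasible I J K t s z w \<and> (\<forall>z' w'. opa_feasible I J K t s z' w' \<longrightarrow> z' \<le> z)"

definition roc_weight :: "nat \<Rightarrow> nat \<Rightarrow> real" where
  "roc_weight K r = (\<Sum>h=r..K. 1 / real h) / real K"

text \<open>
  Equal importance means that all experts share one rank and all attributes share one rank, the
  latter being the same for every expert. It is a property of the coefficients of the linear program
  and, unless there is only one expert and one attribute, excludes that the ranks are permutations.
\<close>

definition equal_importance ::
  "nat \<Rightarrow> nat \<Rightarrow> (nat \<Rightarrow> nat) \<Rightarrow> (nat \<Rightarrow> nat \<Rightarrow> nat) \<Rightarrow> bool"
  where
  "equal_importance I J t s \<longleftrightarrow>
     (\<exists>a\<in>{1..I}. \<forall>i\<in>{1..I}. t i = a) \<and>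
     (\<exists>b\<in>{1..J}. \<forall>i\<in>{1..I}. \<forall>j\<in>{1..J}. s i j = b)"

text \<open>The overall weight of alternative \<open>k\<close> collects its weights over all experts and attributes.\<close>

definition alternative_weight ::
  "nat \<Rightarrow> nat \<Rightarrow> (nat \<Rightarrow> nat \<Rightarrow> nat \<Rightarrow> nat) \<Rightarrow> (nat \<Rightarrow> nat \<Rightarrow> nat \<Rightarrow> real) \<Rightarrow> nat \<Rightarrow> real"
  where
  "alternative_weight I J rk w k = (\<Sum>i=1..I. \<Sum>j=1..J. w i j (rk i j k))"

end

theory Submission
  imports Defs
begin

text \<open>
  Dividing the constraints by \<open>t i * s i j\<close> and summing them bounds \<open>z\<close> by \<open>1 / A\<close>, where \<open>A\<close> is the
  sum of all the coefficients of \<open>z\<close>. The bound is attained exactly when every constraint is tight,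
  which makes \<open>w\<close> proportional to these coefficients. Exchanging summations gives
  \<open>(\<Sum>r=1..K. \<Sum>h=r..K. 1 / h) = K\<close>, and the remaining factor of \<open>A\<close> is
  \<open>\<Sum>i. \<Sum>j. 1 / (t i * s i j)\<close>; it is a product of two harmonic numbers for permutations and a
  multiple of \<open>I * J\<close> for constant ranks.
\<close>

text \<open>Induction: passing to \<open>Suc n\<close> appends \<open>1 / Suc n\<close> to each of
  the \<open>n\<close> old tails and creates one new tail of that value, so the total grows by
  exactly 1.\<close>

lemma sum_harmonic_tails: "(\<Sum>r=1..n. \<Sum>h=r..n. 1 / real h) = real n"
proof (induction n)
  case (Suc n)
  have "(\<Sum>r=1..Suc n. \<Sum>h=r..Suc n. 1 / real h)
      = (\<Sum>r=1..n. (\<Sum>h=r..n. 1 / real h) + 1 / real (Suc n)) + 1 / real (Suc n)"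
    by (simp del: of_nat_Suc)
  also have "\<dots> = real n + (real n + 1) / real (Suc n)"
    using Suc.IH by (simp add: sum.distrib add_divide_distrib del: of_nat_Suc)
  also have "\<dots> = real (Suc n)"
    by simp
  finally show ?case .
qed simp

text \<open>Weak duality with all multipliers equal to 1. The sign of \<open>z\<close> is
  irrelevant, because only the positive number \<open>sum a X\<close> is divided out.\<close>

lemma proportional_lp_bound:
  fixes a w :: "'a \<Rightarrow> real"
  assumes "0 < sum a X" and "sum w X = 1" and "\<And>x. x \<in> X \<Longrightarrow> a x * z \<le> w x"
  shows "z \<le> 1 / sum a X"
proof -
  have "sum a X * z \<le> 1"
    using sum_mono[of X "\<lambda>x. a x * z" w] assms by (simp add: sum_distrib_right)
  then show ?thesis
    using assms(1) by (simp add: field_simps)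
qed

text \<open>Both sides of the constraints sum to 1 over \<open>X\<close>, so the nonnegative slacks
  have sum 0 and each of them vanishes.\<close>

lemma proportional_lp_tight:
  fixes a w :: "'a \<Rightarrow> real"
  assumes "finite X" and "0 < sum a X" and "sum w X = 1"
    and "\<And>x. x \<in> X \<Longrightarrow> a x * (1 / sum a X) \<le> w x" and "x \<in> X"
  shows "w x = a x / sum a X"
proof -
  have "(\<Sum>x\<in>X. a x * (1 / sum a X)) = sum w X"
    using assms(2,3) by (simp flip: sum_divide_distrib)
  from sum_mono_inv[OF this assms(4,5,1)] show ?thesis
    by simp
qed

text \<open>Assuming only positive ranks lets this cover both permutations and constant ranks; the
  two cases differ only in the value of \<open>D\<close>.\<close>

lemma opa_optimal_iff:
  fixes I J K :: nat and t :: "nat \<Rightarrow> nat" and s :: "nat \<Rightarrow> nat \<Rightarrow> nat"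
  defines "D \<equiv> \<Sum>i=1..I. \<Sum>j=1..J. 1 / (real (t i) * real (s i j))"
  assumes "I \<ge> 1" and "J \<ge> 1" and "K \<ge> 1"
    and t_pos: "\<forall>i\<in>{1..I}. 0 < t i"
    and s_pos: "\<forall>i\<in>{1..I}. \<forall>j\<in>{1..J}. 0 < s i j"
  shows "opa_optimal I J K t s z w \<longleftrightarrow>
    z = 1 / (real K * D) \<and>
    (\<forall>i\<in>{1..I}. \<forall>j\<in>{1..J}. \<forall>r\<in>{1..K}. w i j r = roc_weight K r / (real (t i) * real (s i j) * D))"
    (is "_ \<longleftrightarrow> z = ?z \<and> ?closed_form w")
proof -
  \<comment> \<open>The triple index is flattened so that the two abstract lemmas apply;
    \<open>a\<close> is the coefficient of \<open>z\<close> after division by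
    \<open>t i * s i j\<close>.\<close>
  define X where "X = {1..I} \<times> {1..J} \<times> {1..K}"
  define a where
    "a = (\<lambda>(i, j, r). (\<Sum>h=r..K. 1 / real h) / (real (t i) * real (s i j)))"
  define flat :: "(nat \<Rightarrow> nat \<Rightarrow> nat \<Rightarrow> real) \<Rightarrow> nat \<times> nat \<times> nat \<Rightarrow> real"
    where "flat = (\<lambda>w (i, j, r). w i j r)"
  have fin: "finite X"
    by (simp add: X_def)
  have D_pos: "0 < D"
    unfolding D_def using assms by (intro sum_pos) (auto intro!: sum_pos)
  have sum_flat: "sum (flat v) X = (\<Sum>i=1..I. \<Sum>j=1..J. \<Sum>r=1..K. v i j r)" for v
    by (simp add: X_def flat_def sum.cartesian_product)
  have sum_a: "sum a X = real K * D"
  proof -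
    have "sum a X = (\<Sum>i=1..I. \<Sum>j=1..J. \<Sum>r=1..K.
        (\<Sum>h=r..K. 1 / real h) / (real (t i) * real (s i j)))"
      by (simp add: X_def a_def sum.cartesian_product)
    also have "\<dots> = (\<Sum>i=1..I. \<Sum>j=1..J. real K * (1 / (real (t i) * real (s i j))))"
      by (simp only: sum_divide_distrib[symmetric] sum_harmonic_tails) simp
    also have "\<dots> = real K * D"
      by (simp only: D_def sum_distrib_left)
    finally show ?thesis .
  qed
  have A_pos: "0 < sum a X"
    using D_pos \<open>K \<ge> 1\<close> by (simp add: sum_a)
  have feasible_iff: "opa_feasible I J K t s y v \<longleftrightarrow>
      (\<forall>x\<in>X. a x * y \<le> flat v x) \<and> sum (flat v) X = 1 \<and> (\<forall>x\<in>X. 0 \<le> flat v x)" for y v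
  proof -
    have "(\<Sum>h=r..K. 1 / real h) * y \<le> real (t i) * real (s i j) * v i j r
        \<longleftrightarrow> a (i, j, r) * y \<le> flat v (i, j, r)"
      if "i \<in> {1..I}" "j \<in> {1..J}" for i j r
      using bspec[OF t_pos that(1)] bspec[OF bspec[OF s_pos that(1)] that(2)]
      by (simp add: a_def flat_def pos_divide_le_eq mult.commute)
    then show ?thesis
      unfolding opa_feasible_def sum_flat by (auto simp: X_def flat_def)
  qed
  \<comment> \<open>The denominator \<open>K\<close> inside \<open>roc_weight\<close> is the factor
    \<open>K\<close> of \<open>sum a X\<close>.\<close>
  have closed_form_iff: "?closed_form v \<longleftrightarrow> (\<forall>x\<in>X. flat v x = a x / sum a X)" for v
    unfolding sum_a by (simp add: X_def flat_def a_def roc_weight_def mult_ac)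
  have bound: "y \<le> ?z" if "opa_feasible I J K t s y v" for y v
    using proportional_lp_bound[OF A_pos, of "flat v" y] that
    by (simp add: feasible_iff sum_a)
  have feasible: "opa_feasible I J K t s ?z v" if "?closed_form v" for v
  proof -
    have eq: "flat v x = a x / sum a X" if "x \<in> X" for x
      using \<open>?closed_form v\<close> that by (simp only: closed_form_iff)
    have "0 \<le> a x" for x
      by (cases x) (simp add: a_def sum_nonneg)
    moreover have "sum (flat v) X = 1"
      using A_pos by (simp add: eq flip: sum_divide_distrib)
    ultimately show ?thesis
      using A_pos by (simp add: feasible_iff eq sum_a)
  qed
  show ?thesis
  proof
    assume opt: "opa_optimal I J K t s z w"
    \<comment> \<open>The closed form serves as a feasible competitor with value \<open>?z\<close>.
      It forces \<open>z\<close> up to the bound, and then tightness determines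
      \<open>w\<close>.\<close>
    define v where "v = (\<lambda>i j r. roc_weight K r / (real (t i) * real (s i j) * D))"
    have "?z \<le> z"
      using feasible[of v] opt unfolding opa_optimal_def v_def by blast
    with bound opt have z: "z = ?z"
      unfolding opa_optimal_def by (meson antisym)
    have "flat w x = a x / sum a X" if "x \<in> X" for x
      using opt proportional_lp_tight[OF fin A_pos _ _ that, of "flat w"]
      by (simp add: opa_optimal_def feasible_iff z sum_a)
    with z show "z = ?z \<and> ?closed_form w"
      by (simp only: closed_form_iff) blast
  next
    assume "z = ?z \<and> ?closed_form w"
    then show "opa_optimal I J K t s z w"
      using feasible[of w] bound by (auto simp: opa_optimal_def)
  qed
qed

lemma opa_optimal_exists:
  assumes "I \<ge> 1" and "J \<ge> 1" and "K \<ge> 1"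
    and "\<forall>i\<in>{1..I}. 0 < t i"
    and "\<forall>i\<in>{1..I}. \<forall>j\<in>{1..J}. 0 < s i j"
  shows "\<exists>z w. opa_optimal I J K t s z w"
  \<comment> \<open>The witnesses stay schematic and are read off from the equations of the
    characterisation.\<close>
  by (intro exI, rule opa_optimal_iff[THEN iffD2, OF assms]) auto

theorem corollary1:
  fixes I J K :: nat
    and t :: "nat \<Rightarrow> nat"
    and s :: "nat \<Rightarrow> nat \<Rightarrow> nat"
    and rk :: "nat \<Rightarrow> nat \<Rightarrow> nat \<Rightarrow> nat"
  assumes "I \<ge> 1" and "J \<ge> 1" and "K \<ge> 1"
    and "no_missing_or_duplicate_rankings I J K t s rk"
  shows
    "(\<exists>z w. opa_optimal I J K t s z w) \<and>
     (\<forall>z w. opa_optimal I J K t s z w \<longrightarrow>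
        (\<forall>i\<in>{1..I}. \<forall>j\<in>{1..J}. \<forall>r\<in>{1..K}.
           w i j r = roc_weight K r /
             (real (t i) * real (s i j) * (\<Sum>p=1..I. 1 / real p) * (\<Sum>q=1..J. 1 / real q)))) \<and>
     (\<forall>t' s'. equal_importance I J t' s' \<longrightarrow>
        (\<exists>z w. opa_optimal I J K t' s' z w) \<and>
        (\<forall>z w. opa_optimal I J K t' s' z w \<longrightarrow>
           (\<forall>i\<in>{1..I}. \<forall>j\<in>{1..J}. \<forall>r\<in>{1..K}.
              w i j r = roc_weight K r / (real I * real J)) \<and>
           (\<forall>k\<in>{1..K}. alternative_weight I J rk w k =
              (\<Sum>i=1..I. \<Sum>j=1..J. roc_weight K (rk i j k)) / (real I * real J)) \<and>
           (\<forall>k\<in>{1..K}. \<forall>r\<in>{1..K}. (\<forall>i\<in>{1..I}. \<forall>j\<in>{1..J}. rk i j k = r) \<longrightarrow>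
              alternative_weight I J rk w k = roc_weight K r)))"
proof (intro conjI allI impI)
  have t: "bij_betw t {1..I} {1..I}"
    and s: "\<And>i. i \<in> {1..I} \<Longrightarrow> bij_betw (s i) {1..J} {1..J}"
    using assms(4) by (auto simp: no_missing_or_duplicate_rankings_def)
  have t_pos: "\<forall>i\<in>{1..I}. 0 < t i"
    using bij_betwE[OF t] by fastforce
  have s_pos: "\<forall>i\<in>{1..I}. \<forall>j\<in>{1..J}. 0 < s i j"
    using bij_betwE[OF s] by fastforce
  show "\<exists>z w. opa_optimal I J K t s z w"
    by (rule opa_optimal_exists[OF assms(1-3) t_pos s_pos])
  \<comment> \<open>Reindexing by \<open>s i\<close> comes first: it makes the inner sum independent
    of \<open>i\<close>, so that it can be pulled out before reindexing by \<open>t\<close>.\<close>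
  have "(\<Sum>i=1..I. \<Sum>j=1..J. 1 / (real (t i) * real (s i j)))
      = (\<Sum>i=1..I. 1 / real (t i) * (\<Sum>j=1..J. 1 / real (s i j)))"
    by (simp add: sum_distrib_left)
  also have "\<dots> = (\<Sum>i=1..I. 1 / real (t i) * (\<Sum>q=1..J. 1 / real q))"
    by (intro sum.cong refl arg_cong2[where f = "(*)"] sum.reindex_bij_betw s)
  also have "\<dots> = (\<Sum>p=1..I. 1 / real p) * (\<Sum>q=1..J. 1 / real q)"
    by (simp only: sum_distrib_right[symmetric]
        sum.reindex_bij_betw[OF t, of "\<lambda>p. 1 / real p"])
  finally have D: "(\<Sum>i=1..I. \<Sum>j=1..J. 1 / (real (t i) * real (s i j)))
      = (\<Sum>p=1..I. 1 / real p) * (\<Sum>q=1..J. 1 / real q)" .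
  show "\<forall>i\<in>{1..I}. \<forall>j\<in>{1..J}. \<forall>r\<in>{1..K}.
           w i j r = roc_weight K r /
             (real (t i) * real (s i j) * (\<Sum>p=1..I. 1 / real p) * (\<Sum>q=1..J. 1 / real q))"
    if "opa_optimal I J K t s z w" for z w
    using that unfolding opa_optimal_iff[OF assms(1-3) t_pos s_pos] D mult.assoc by (rule conjunct2)
next
  fix t' s'
  assume eq: "equal_importance I J t' s'"
  then obtain a b where a: "a \<in> {1..I}" "\<And>i. i \<in> {1..I} \<Longrightarrow> t' i = a"
    and b: "b \<in> {1..J}" "\<And>i j. i \<in> {1..I} \<Longrightarrow> j \<in> {1..J} \<Longrightarrow> s' i j = b"
    by (auto simp: equal_importance_def)
  have t_pos: "\<forall>i\<in>{1..I}. 0 < t' i"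
    using a by simp
  have s_pos: "\<forall>i\<in>{1..I}. \<forall>j\<in>{1..J}. 0 < s' i j"
    using b by simp
  show "\<exists>z w. opa_optimal I J K t' s' z w"
    by (rule opa_optimal_exists[OF assms(1-3) t_pos s_pos])
  have D: "(\<Sum>i=1..I. \<Sum>j=1..J. 1 / (real (t' i) * real (s' i j)))
      = real I * real J / (real a * real b)"
    by (simp add: a(2) b(2))
  fix z w
  assume "opa_optimal I J K t' s' z w"
  then have "w i j r = roc_weight K r / (real (t' i) * real (s' i j) * (real I * real J / (real a * real b)))"
    if "i \<in> {1..I}" "j \<in> {1..J}" "r \<in> {1..K}" for i j r
    using that by (simp only: opa_optimal_iff[OF assms(1-3) t_pos s_pos] D)
  \<comment> \<open>The common ranks \<open>a\<close> and \<open>b\<close> cancel against those in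
    \<open>D\<close>, so it does not matter which ranks are shared.\<close>
  then have w: "w i j r = roc_weight K r / (real I * real J)"
    if "i \<in> {1..I}" "j \<in> {1..J}" "r \<in> {1..K}" for i j r
    using that a b by simp
  then show "\<forall>i\<in>{1..I}. \<forall>j\<in>{1..J}. \<forall>r\<in>{1..K}. w i j r = roc_weight K r / (real I * real J)"
    by blast
  \<comment> \<open>The formula for \<open>w\<close> holds only for ranks in \<open>{1..K}\<close>,
    so each \<open>rk i j k\<close> must be shown to lie there.\<close>
  have rk: "rk i j k \<in> {1..K}" if "i \<in> {1..I}" "j \<in> {1..J}" "k \<in> {1..K}" for i j k
    using assms(4) that bij_betwE unfolding no_missing_or_duplicate_rankings_def by blast
  have alt: "alternative_weight I J rk w k
      = (\<Sum>i=1..I. \<Sum>j=1..J. roc_weight K (rk i j k)) / (real I * real J)"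
    if "k \<in> {1..K}" for k
    unfolding alternative_weight_def sum_divide_distrib
    using that by (intro sum.cong refl w rk)
  then show "\<forall>k\<in>{1..K}. alternative_weight I J rk w k
      = (\<Sum>i=1..I. \<Sum>j=1..J. roc_weight K (rk i j k)) / (real I * real J)"
    by blast
  \<comment> \<open>With a unanimous rank all \<open>I * J\<close> summands coincide, and their
    number cancels the denominator, which is nonzero.\<close>
  show "\<forall>k\<in>{1..K}. \<forall>r\<in>{1..K}. (\<forall>i\<in>{1..I}. \<forall>j\<in>{1..J}. rk i j k = r) \<longrightarrow>
      alternative_weight I J rk w k = roc_weight K r"
    using assms(1,2) by (simp add: alt)
qed

end
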